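(* Let $v\ge1$ and $n=2^v$. The context $\mathbf{K}[v,1]$ has exactly $2n$ prime orbits, namely the following $2n$ sets of minterms $m_s\wedge\bigwedge_{i=0}^{n-1}\Diamond^{\varepsilon_i}m_i$ (with $s$ ranging over $0,\dots,n-1$ in each case): $\mathrm{Vv}_0$: those with $\varepsilon_i=0$ for all $i$; $\mathrm{Dd}_0$: those with $\varepsilon_s=1$ and $\varepsilon_i=0$ for all $i\ne s$; $\mathrm{Dc}_k$ ($1\le k<n$): those with $\varepsilon_s=0$ and exactly $k$ indices $i\ne s$ with $\varepsilon_i=1$; $\mathrm{Dw}_k$ ($1\le k<n$): those with $\varepsilon_s=1$ and exactly $k$ indices $i\ne s$ with $\varepsilon_i=1$. (Each of $\mathrm{Dc}_k,\mathrm{Dw}_k$ thus has $\binom{n-1}{k}$ minterms in each section $s$.)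
   Context: $m_0,\dots,m_{n-1}$ enumerate the $n=2^v$ Boolean minterms $\bigwedge_{k=0}^{v-1}\pm p_k$ in the variables $p_0,\dots,p_{v-1}$. For $\varepsilon_i\in\{0,1\}$, $\Diamond^{1}m_i=\Diamond m_i$ and $\Diamond^{0}m_i=\neg\Diamond m_i$. $\mathbf{K}[v,1]$ is the Lindenbaum–Tarski algebra (modulo provable equivalence in the least normal modal logic $\mathbf{K}$) of formulas in $p_0,\dots,p_{v-1}$ of modal degree $\le1$; its atoms (minterms) are exactly the formulas $m_s\wedge\bigwedge_{i=0}^{n-1}\Diamond^{\varepsilon_i}m_i$, $0\le s<n$, $\varepsilon\in\{0,1\}^n$; $s$ is the section of the minterm. A level-0 substitution is a tuple $(\sigma_0,\dots,\sigma_{v-1})$ of classical propositional formulas in $p_0,\dots,p_{v-1}$ acting by $\varphi\circ\sigma=\varphi(\sigma_0,\dots,\sigma_{v-1})$; under composition $(\sigma\sigma')_i=\sigma_i(\sigma'_0,\dots,\sigma'_{v-1})$ they form a monoid whose invertible elements (prime substitutions) form a group $\mathcal{S}_p(v,0)$, acting on the minterms of $\mathbf{K}[v,1]$ by $\mu\mapsto\mu\circ\varsigma$. The orbits of this action are the prime orbits of $\mathbf{K}[v,1]$. *)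

theory Defs
  imports "HOL-Algebra.Group_Action"
begin

section \<open>Modal formulas and the least normal modal logic\<close>

datatype fm = Var nat | Fls | Imp fm fm | Box fm

abbreviation Neg :: "fm \<Rightarrow> fm" where "Neg A \<equiv> Imp A Fls"
abbreviation Tru :: fm where "Tru \<equiv> Neg Fls"
abbreviation Con :: "fm \<Rightarrow> fm \<Rightarrow> fm" where "Con A B \<equiv> Neg (Imp A (Neg B))"
abbreviation Dis :: "fm \<Rightarrow> fm \<Rightarrow> fm" where "Dis A B \<equiv> Imp (Neg A) B"
abbreviation Dia :: "fm \<Rightarrow> fm" where "Dia A \<equiv> Neg (Box (Neg A))"

definition BigCon :: "fm list \<Rightarrow> fm" where
  "BigCon As = foldr Con As Tru"

primrec vars :: "fm \<Rightarrow> nat set" where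
  "vars (Var k) = {k}"
| "vars Fls = {}"
| "vars (Imp A B) = vars A \<union> vars B"
| "vars (Box A) = vars A"

primrec deg :: "fm \<Rightarrow> nat" where
  "deg (Var k) = 0"
| "deg Fls = 0"
| "deg (Imp A B) = max (deg A) (deg B)"
| "deg (Box A) = Suc (deg A)"

primrec subst :: "(nat \<Rightarrow> fm) \<Rightarrow> fm \<Rightarrow> fm" where
  "subst \<tau> (Var k) = \<tau> k"
| "subst \<tau> Fls = Fls"
| "subst \<tau> (Imp A B) = Imp (subst \<tau> A) (subst \<tau> B)"
| "subst \<tau> (Box A) = Box (subst \<tau> A)"

text \<open>Classical truth value, with variables and boxed formulas valued arbitrarily.\<close>

primrec tval :: "(nat \<Rightarrow> bool) \<Rightarrow> (fm \<Rightarrow> bool) \<Rightarrow> fm \<Rightarrow> bool" where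
  "tval g h (Var k) = g k"
| "tval g h Fls = False"
| "tval g h (Imp A B) = (tval g h A \<longrightarrow> tval g h B)"
| "tval g h (Box A) = h A"

definition tautology :: "fm \<Rightarrow> bool" where
  "tautology A \<longleftrightarrow> (\<forall>g h. tval g h A)"

inductive K_provable :: "fm \<Rightarrow> bool" where
  taut: "tautology A \<Longrightarrow> K_provable A"
| axK: "K_provable (Imp (Box (Imp A B)) (Imp (Box A) (Box B)))"
| MP: "K_provable (Imp A B) \<Longrightarrow> K_provable A \<Longrightarrow> K_provable B"
| Nec: "K_provable A \<Longrightarrow> K_provable (Box A)"
| Subst: "K_provable A \<Longrightarrow> K_provable (subst \<tau> A)"

definition K_equiv :: "fm \<Rightarrow> fm \<Rightarrow> bool" where
  "K_equiv A B \<longleftrightarrow> K_provable (Con (Imp A B) (Imp B A))"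

lemma K_taut1: "K_provable A \<Longrightarrow> tautology (Imp A B) \<Longrightarrow> K_provable B"
  using MP taut by blast

lemma K_taut2:
  "K_provable A \<Longrightarrow> K_provable B \<Longrightarrow> tautology (Imp A (Imp B C)) \<Longrightarrow> K_provable C"
  using MP taut by blast

lemma K_equiv_iff: "K_equiv A B \<longleftrightarrow> K_provable (Imp A B) \<and> K_provable (Imp B A)"
proof
  assume "K_equiv A B"
  then have p: "K_provable (Con (Imp A B) (Imp B A))" by (simp add: K_equiv_def)
  show "K_provable (Imp A B) \<and> K_provable (Imp B A)"
    by (intro conjI; rule K_taut1[OF p]; simp add: tautology_def)
next
  assume "K_provable (Imp A B) \<and> K_provable (Imp B A)"
  then have "K_provable (Imp A B)" "K_provable (Imp B A)" by auto
  then show "K_equiv A B" unfolding K_equiv_def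
    by (rule K_taut2) (simp add: tautology_def)
qed

lemma K_refl: "K_provable (Imp A A)"
  by (rule taut) (simp add: tautology_def)

lemma K_trans: "K_provable (Imp A B) \<Longrightarrow> K_provable (Imp B C) \<Longrightarrow> K_provable (Imp A C)"
  by (erule K_taut2, assumption) (simp add: tautology_def)

lemma K_imp_mono:
  "K_provable (Imp A' A) \<Longrightarrow> K_provable (Imp B B') \<Longrightarrow> K_provable (Imp (Imp A B) (Imp A' B'))"
  by (erule K_taut2, assumption) (simp add: tautology_def)

lemma K_box_mono: "K_provable (Imp A B) \<Longrightarrow> K_provable (Imp (Box A) (Box B))"
  using Nec axK MP by blast

lemma K_equiv_equivp: "equivp K_equiv"
  by (rule equivpI)
    (auto simp: reflp_def symp_def transp_def K_equiv_iff intro: K_refl K_trans)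

lemma K_equiv_Imp: "K_equiv A A' \<Longrightarrow> K_equiv B B' \<Longrightarrow> K_equiv (Imp A B) (Imp A' B')"
  by (auto simp: K_equiv_iff intro: K_imp_mono)

lemma K_equiv_Box: "K_equiv A A' \<Longrightarrow> K_equiv (Box A) (Box A')"
  by (auto simp: K_equiv_iff intro: K_box_mono)

lemma K_equiv_refl: "K_equiv A A"
  by (simp add: K_equiv_iff K_refl)

lemma K_equiv_subst:
  assumes "\<And>k. K_equiv (\<tau> k) (\<tau>' k)" and "K_equiv A B"
  shows "K_equiv (subst \<tau> A) (subst \<tau>' B)"
proof -
  have "K_equiv (subst \<tau> A) (subst \<tau> B)"
    using assms(2) Subst[of "Imp A B" \<tau>] Subst[of "Imp B A" \<tau>] by (simp add: K_equiv_iff)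
  moreover have "K_equiv (subst \<tau> B) (subst \<tau>' B)"
    by (induction B) (simp_all add: assms(1) K_equiv_Imp K_equiv_Box K_equiv_refl)
  ultimately show ?thesis
    using K_equiv_equivp by (meson equivp_transp)
qed

section \<open>The Lindenbaum--Tarski algebra\<close>

quotient_type lindenbaum = fm / K_equiv morphisms rep_lind cls
  by (rule K_equiv_equivp)

instantiation lindenbaum :: boolean_algebra
begin

lift_definition less_eq_lindenbaum :: "lindenbaum \<Rightarrow> lindenbaum \<Rightarrow> bool"
  is "\<lambda>A B. K_provable (Imp A B)"
  by (meson K_equiv_iff K_trans)

definition less_lindenbaum :: "lindenbaum \<Rightarrow> lindenbaum \<Rightarrow> bool" where
  "less_lindenbaum x y \<longleftrightarrow> x \<le> y \<and> \<not> y \<le> x"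

lift_definition bot_lindenbaum :: lindenbaum is Fls .
lift_definition top_lindenbaum :: lindenbaum is Tru .
lift_definition uminus_lindenbaum :: "lindenbaum \<Rightarrow> lindenbaum" is Neg
  by (intro K_equiv_Imp K_equiv_refl)
lift_definition inf_lindenbaum :: "lindenbaum \<Rightarrow> lindenbaum \<Rightarrow> lindenbaum" is Con
  by (intro K_equiv_Imp K_equiv_refl)
lift_definition sup_lindenbaum :: "lindenbaum \<Rightarrow> lindenbaum \<Rightarrow> lindenbaum" is Dis
  by (intro K_equiv_Imp K_equiv_refl)
definition minus_lindenbaum :: "lindenbaum \<Rightarrow> lindenbaum \<Rightarrow> lindenbaum" where
  "minus_lindenbaum x y = inf x (- y)"

instance
proof
  fix x y z :: lindenbaum
  show "(x < y) = (x \<le> y \<and> \<not> y \<le> x)" by (simp add: less_lindenbaum_def)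
  show "x \<le> x" by transfer (rule K_refl)
  show "x \<le> y \<Longrightarrow> y \<le> z \<Longrightarrow> x \<le> z" by transfer (rule K_trans)
  show "x \<le> y \<Longrightarrow> y \<le> x \<Longrightarrow> x = y" by transfer (simp add: K_equiv_iff)
  show "inf x y \<le> x" by transfer (auto intro!: taut simp: tautology_def)
  show "inf x y \<le> y" by transfer (auto intro!: taut simp: tautology_def)
  show "x \<le> y \<Longrightarrow> x \<le> z \<Longrightarrow> x \<le> inf y z"
    by transfer (erule K_taut2, assumption, simp add: tautology_def)
  show "x \<le> sup x y" by transfer (auto intro!: taut simp: tautology_def)
  show "y \<le> sup x y" by transfer (auto intro!: taut simp: tautology_def)
  show "y \<le> x \<Longrightarrow> z \<le> x \<Longrightarrow> sup y z \<le> x"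
    by transfer (erule K_taut2, assumption, auto simp: tautology_def)
  show "bot \<le> x" by transfer (auto intro!: taut simp: tautology_def)
  show "x \<le> Orderings.top" by transfer (auto intro!: taut simp: tautology_def)
  show "sup x (inf y z) = inf (sup x y) (sup x z)"
    by transfer (auto intro!: taut simp: tautology_def K_equiv_iff)
  show "inf x (- x) = bot" by transfer (auto intro!: taut simp: tautology_def K_equiv_iff)
  show "sup x (- x) = Orderings.top" by transfer (auto intro!: taut simp: tautology_def K_equiv_iff)
  show "x - y = inf x (- y)" by (simp add: minus_lindenbaum_def)
qed

end

text \<open>
  The algebra \<open>\<^bold>K[v,d]\<close>, realised inside the algebra of all formulas: the classes having a
  representative in \<open>p\<^sub>0, \<dots>, p\<^sub>v\<^sub>-\<^sub>1\<close> of modal degree at most \<open>d\<close>.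
\<close>

definition K_ctx :: "nat \<Rightarrow> nat \<Rightarrow> lindenbaum set" where
  "K_ctx v d = {cls A | A. vars A \<subseteq> {..<v} \<and> deg A \<le> d}"

definition minterms :: "nat \<Rightarrow> nat \<Rightarrow> lindenbaum set" where
  "minterms v d =
    {\<mu> \<in> K_ctx v d. \<mu> \<noteq> bot \<and> (\<forall>x \<in> K_ctx v d. x \<le> \<mu> \<longrightarrow> x = bot \<or> x = \<mu>)}"

section \<open>Substitutions and prime orbits\<close>

lift_definition lsubst :: "(nat \<Rightarrow> lindenbaum) \<Rightarrow> lindenbaum \<Rightarrow> lindenbaum" is subst
  by (rule K_equiv_subst) (auto simp: rel_fun_def)

text \<open>
  Level-0 substitutions are taken modulo provable equivalence; on literal formulas the only
  invertible tuples would be the permutations of the variables. The tuple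
  \<open>(\<sigma>\<^sub>0, \<dots>, \<sigma>\<^sub>v\<^sub>-\<^sub>1)\<close> is encoded by the total substitution that extends it by \<open>p\<^sub>k\<close> for \<open>k \<ge> v\<close>.
\<close>

definition subst_monoid :: "nat \<Rightarrow> (nat \<Rightarrow> lindenbaum) monoid" where
  "subst_monoid v =
    \<lparr>carrier = {\<sigma>. (\<forall>k<v. \<sigma> k \<in> K_ctx v 0) \<and> (\<forall>k\<ge>v. \<sigma> k = cls (Var k))},
     monoid.mult = (\<lambda>\<sigma> \<sigma>'. \<lambda>i. lsubst \<sigma>' (\<sigma> i)),
     one = (\<lambda>k. cls (Var k))\<rparr>"

definition prime_substs :: "nat \<Rightarrow> (nat \<Rightarrow> lindenbaum) monoid" where
  "prime_substs v = units_of (subst_monoid v)"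

definition prime_orbits :: "nat \<Rightarrow> nat \<Rightarrow> lindenbaum set set" where
  "prime_orbits v d = orbits (prime_substs v) (minterms v d) lsubst"

lemma lsubst_cls: "lsubst (\<lambda>k. cls (\<tau> k)) (cls A) = cls (subst \<tau> A)"
proof -
  have "rel_fun (=) cr_lindenbaum \<tau> (\<lambda>k. cls (\<tau> k))"
    by (auto simp: rel_fun_def cr_lindenbaum_def)
  moreover have "cr_lindenbaum A (cls A)"
    by (simp add: cr_lindenbaum_def)
  ultimately have "cr_lindenbaum (subst \<tau> A) (lsubst (\<lambda>k. cls (\<tau> k)) (cls A))"
    using lsubst.transfer unfolding lindenbaum.pcr_cr_eq by (auto simp: rel_fun_def)
  then show ?thesis by (simp add: cr_lindenbaum_def)
qed

lemma cls_rep: "cls (rep_lind x) = x"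
  by (rule Quotient3_abs_rep[OF Quotient3_lindenbaum])

lemma lsubst_Var: "lsubst \<sigma> (cls (Var k)) = \<sigma> k"
  using lsubst_cls[of "\<lambda>k. rep_lind (\<sigma> k)" "Var k"] by (simp add: cls_rep)

lemma subst_Var: "subst Var A = A"
  by (induction A) auto

lemma subst_subst: "subst \<tau> (subst \<tau>' A) = subst (\<lambda>k. subst \<tau> (\<tau>' k)) A"
  by (induction A) auto

lemma lsubst_id: "lsubst (\<lambda>k. cls (Var k)) x = x"
  using lsubst_cls[of Var "rep_lind x"] by (simp add: cls_rep subst_Var)

lemma lsubst_lsubst: "lsubst \<sigma>' (lsubst \<sigma> x) = lsubst (\<lambda>k. lsubst \<sigma>' (\<sigma> k)) x"
proof -
  define t where "t = (\<lambda>k. rep_lind (\<sigma> k))"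
  define t' where "t' = (\<lambda>k. rep_lind (\<sigma>' k))"
  define A where "A = rep_lind x"
  have eq: "\<sigma> = (\<lambda>k. cls (t k))" "\<sigma>' = (\<lambda>k. cls (t' k))" "x = cls A"
    by (simp_all add: t_def t'_def A_def cls_rep)
  show ?thesis unfolding eq lsubst_cls subst_subst ..
qed

lemma vars_subst: "vars (subst \<tau> A) = (\<Union>k\<in>vars A. vars (\<tau> k))"
  by (induction A) auto

lemma deg_subst: "(\<And>k. k \<in> vars A \<Longrightarrow> deg (\<tau> k) = 0) \<Longrightarrow> deg (subst \<tau> A) = deg A"
  by (induction A) auto

lemma lsubst_K_ctx:
  assumes \<sigma>: "\<sigma> \<in> carrier (subst_monoid v)" and x: "x \<in> K_ctx v d"
  shows "lsubst \<sigma> x \<in> K_ctx v d"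
proof -
  have "\<exists>B. \<sigma> k = cls B \<and> (k < v \<longrightarrow> vars B \<subseteq> {..<v} \<and> deg B = 0)" for k
    using \<sigma> by (cases "k < v") (auto simp: subst_monoid_def K_ctx_def)
  then obtain t where t: "\<And>k. \<sigma> k = cls (t k)"
    "\<And>k. k < v \<Longrightarrow> vars (t k) \<subseteq> {..<v} \<and> deg (t k) = 0"
    by metis
  obtain A where A: "x = cls A" "vars A \<subseteq> {..<v}" "deg A \<le> d"
    using x by (auto simp: K_ctx_def)
  have "\<sigma> = (\<lambda>k. cls (t k))" using t(1) by auto
  then have "lsubst \<sigma> x = cls (subst t A)" by (simp add: A lsubst_cls)
  moreover have "vars (subst t A) \<subseteq> {..<v}" using t(2) A(2) by (fastforce simp: vars_subst)
  moreover have "deg (subst t A) \<le> d" using t(2) A(2,3) by (subst deg_subst) auto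
  ultimately show ?thesis by (auto simp: K_ctx_def)
qed

lemma subst_monoid: "monoid (subst_monoid v)"
proof (rule monoidI)
  show "x \<otimes>\<^bsub>subst_monoid v\<^esub> y \<in> carrier (subst_monoid v)"
    if "x \<in> carrier (subst_monoid v)" "y \<in> carrier (subst_monoid v)" for x y
    using that lsubst_K_ctx[OF that(2)] by (auto simp: subst_monoid_def lsubst_Var)
  show "\<one>\<^bsub>subst_monoid v\<^esub> \<in> carrier (subst_monoid v)"
    by (force simp: subst_monoid_def K_ctx_def)
qed (auto simp: subst_monoid_def lsubst_lsubst lsubst_Var lsubst_id)

lemma prime_substs_group: "group (prime_substs v)"
  unfolding prime_substs_def by (rule monoid.units_group[OF subst_monoid])

section \<open>Explicit minterms\<close>

text \<open>The Boolean minterms \<open>\<And>\<^sub>k\<^sub><\<^sub>v \<plusminus>p\<^sub>k\<close>; \<open>b\<close> gives the signs.\<close>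

definition bool_minterm :: "nat \<Rightarrow> (nat \<Rightarrow> bool) \<Rightarrow> fm" where
  "bool_minterm v b = BigCon (map (\<lambda>k. if b k then Var k else Neg (Var k)) [0..<v])"

definition enumerates_bool_minterms :: "nat \<Rightarrow> (nat \<Rightarrow> fm) \<Rightarrow> bool" where
  "enumerates_bool_minterms v m \<longleftrightarrow> bij_betw m {..<2 ^ v} (range (bool_minterm v))"

definition Dia_sgn :: "bool \<Rightarrow> fm \<Rightarrow> fm" where
  "Dia_sgn e A = (if e then Dia A else Neg (Dia A))"

definition minterm1 :: "nat \<Rightarrow> (nat \<Rightarrow> fm) \<Rightarrow> nat \<Rightarrow> (nat \<Rightarrow> bool) \<Rightarrow> lindenbaum" where
  "minterm1 v m s \<epsilon> = cls (Con (m s) (BigCon (map (\<lambda>i. Dia_sgn (\<epsilon> i) (m i)) [0..<2 ^ v])))"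

definition section_minterms :: "nat \<Rightarrow> (nat \<Rightarrow> fm) \<Rightarrow> nat \<Rightarrow> lindenbaum set" where
  "section_minterms v m s = {minterm1 v m s \<epsilon> | \<epsilon>. True}"

definition Vv0 :: "nat \<Rightarrow> (nat \<Rightarrow> fm) \<Rightarrow> lindenbaum set" where
  "Vv0 v m = {minterm1 v m s \<epsilon> | s \<epsilon>. s < 2 ^ v \<and> (\<forall>i < 2 ^ v. \<not> \<epsilon> i)}"

definition Dd0 :: "nat \<Rightarrow> (nat \<Rightarrow> fm) \<Rightarrow> lindenbaum set" where
  "Dd0 v m = {minterm1 v m s \<epsilon> | s \<epsilon>. s < 2 ^ v \<and> \<epsilon> s \<and> (\<forall>i < 2 ^ v. i \<noteq> s \<longrightarrow> \<not> \<epsilon> i)}"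

definition Dc :: "nat \<Rightarrow> (nat \<Rightarrow> fm) \<Rightarrow> nat \<Rightarrow> lindenbaum set" where
  "Dc v m k = {minterm1 v m s \<epsilon> | s \<epsilon>.
     s < 2 ^ v \<and> \<not> \<epsilon> s \<and> card {i. i < 2 ^ v \<and> i \<noteq> s \<and> \<epsilon> i} = k}"

definition Dw :: "nat \<Rightarrow> (nat \<Rightarrow> fm) \<Rightarrow> nat \<Rightarrow> lindenbaum set" where
  "Dw v m k = {minterm1 v m s \<epsilon> | s \<epsilon>.
     s < 2 ^ v \<and> \<epsilon> s \<and> card {i. i < 2 ^ v \<and> i \<noteq> s \<and> \<epsilon> i} = k}"

end

theory Submission
  imports Defs "HOL-Combinatorics.Permutations"
begin

text \<open>
  A minterm of \<open>\<^bold>K[v,1]\<close> is coded by a pair \<open>(s, E)\<close> with \<open>s < n\<close> and \<open>E \<subseteq> {0, \<dots>, n - 1}\<close> the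
  set of indices \<open>i\<close> with \<open>\<epsilon>\<^sub>i = 1\<close>. Kripke soundness, applied to a root whose successors are dead
  ends, shows that different pairs give different classes. A prime substitution permutes the
  Boolean minterms, every permutation of \<open>{0, \<dots>, n - 1}\<close> arises in this way, and the induced action
  on pairs is \<open>(s, E) \<mapsto> (\<pi> s, \<pi> ` E)\<close>. Two pairs are therefore in the same orbit iff they agree on
  whether \<open>s \<in> E\<close> and on the cardinality of \<open>E - {s}\<close>.
\<close>

section \<open>Propositional reasoning in \<open>\<^bold>K\<close>\<close>

text \<open>Premises move one at a time into the conclusion as antecedents until a single tautology
  remains. Later provability claims thereby reduce to evaluating \<open>tval\<close>, with boxed
  formulas as atoms.\<close>

lemma K_taut_consequence:
  assumes "finite Ps" "\<And>P. P \<in> Ps \<Longrightarrow> K_provable P"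
    and "\<And>g h. (\<And>P. P \<in> Ps \<Longrightarrow> tval g h P) \<Longrightarrow> tval g h C"
  shows "K_provable C"
  using assms
proof (induction Ps arbitrary: C rule: finite_induct)
  case empty
  then show ?case by (simp add: taut tautology_def)
next
  case (insert P Ps)
  have "K_provable (Imp P C)"
  proof (rule insert.IH)
    show "tval g h (Imp P C)" if "\<And>Q. Q \<in> Ps \<Longrightarrow> tval g h Q" for g h
      using that insert.prems(2)[of g h] by (metis insert_iff tval.simps(3))
  qed (use insert.prems(1) in blast)
  then show ?case using MP insert.prems(1) by blast
qed

text \<open>Normality under a hypothesis \<open>M\<close>: the same induction, with necessitation in
  the base case and \<open>axK\<close> to detach each premise.\<close>

lemma K_box_consequence:
  assumes "finite Ps" "\<And>P. P \<in> Ps \<Longrightarrow> K_provable (Imp M (Box P))"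
    and "\<And>g h. (\<And>P. P \<in> Ps \<Longrightarrow> tval g h P) \<Longrightarrow> tval g h B"
  shows "K_provable (Imp M (Box B))"
  using assms
proof (induction Ps arbitrary: B rule: finite_induct)
  case empty
  then have "K_provable (Box B)" by (intro Nec taut) (simp add: tautology_def)
  then show ?case by (rule K_taut1) (simp add: tautology_def)
next
  case (insert P Ps)
  have "K_provable (Imp M (Box (Imp P B)))"
  proof (rule insert.IH)
    show "tval g h (Imp P B)" if "\<And>Q. Q \<in> Ps \<Longrightarrow> tval g h Q" for g h
      using that insert.prems(2)[of g h] by (metis insert_iff tval.simps(3))
  qed (use insert.prems(1) in blast)
  moreover have "K_provable (Imp M (Box P))" using insert.prems by blast
  ultimately have "K_provable (Imp M (Imp (Box P) (Box B)))" "K_provable (Imp M (Box P))"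
    using K_trans axK by blast+
  then show ?case by (rule K_taut2) (simp add: tautology_def)
qed

lemma cls_eq_if_tval_eq: "(\<And>g h. tval g h A = tval g h B) \<Longrightarrow> cls A = cls B"
  unfolding lindenbaum.abs_eq_iff K_equiv_iff by (auto intro!: taut simp: tautology_def)

lemma tval_BigCon [simp]: "tval g h (BigCon As) \<longleftrightarrow> (\<forall>A\<in>set As. tval g h A)"
  unfolding BigCon_def by (induction As) auto

lemma vars_BigCon [simp]: "vars (BigCon As) = (\<Union>A\<in>set As. vars A)"
  unfolding BigCon_def by (induction As) auto

lemma deg_BigCon_le: "(\<And>A. A \<in> set As \<Longrightarrow> deg A \<le> d) \<Longrightarrow> deg (BigCon As) \<le> d"
  unfolding BigCon_def by (induction As) auto

lemma subst_BigCon [simp]: "subst \<tau> (BigCon As) = BigCon (map (subst \<tau>) As)"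
  unfolding BigCon_def by (induction As) auto

lemma tval_cong:
  assumes "deg A = 0" "\<And>k. k \<in> vars A \<Longrightarrow> g k = g' k"
  shows "tval g h A = tval g' h' A"
  using assms by (induction A) auto

lemma tval_subst:
  assumes "deg A = 0"
  shows "tval g h (subst \<tau> A) = tval (\<lambda>k. tval g h (\<tau> k)) h' A"
  using assms by (induction A) auto

section \<open>Kripke semantics\<close>

primrec sem :: "('w \<Rightarrow> 'w \<Rightarrow> bool) \<Rightarrow> ('w \<Rightarrow> nat \<Rightarrow> bool) \<Rightarrow> 'w \<Rightarrow> fm \<Rightarrow> bool" where
  "sem R V w (Var k) = V w k"
| "sem R V w Fls = False"
| "sem R V w (Imp A B) = (sem R V w A \<longrightarrow> sem R V w B)"
| "sem R V w (Box A) = (\<forall>u. R w u \<longrightarrow> sem R V u A)"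

text \<open>Seen from one world, boxed formulas are atoms whose values the successors dictate, so
  facts about \<open>tval\<close> carry over to Kripke models.\<close>

lemma sem_tval: "sem R V w A = tval (V w) (\<lambda>B. \<forall>u. R w u \<longrightarrow> sem R V u B) A"
  by (induction A) auto

lemma sem_subst: "sem R V w (subst \<tau> A) = sem R (\<lambda>u k. sem R V u (\<tau> k)) w A"
  by (induction A arbitrary: w) auto

lemma K_sound: "K_provable A \<Longrightarrow> sem R V w A"
\<comment> \<open>The rule \<open>Subst\<close> changes the valuation and \<open>Nec\<close> moves
  to other worlds, so both must vary.\<close>
proof (induction arbitrary: V w rule: K_provable.induct)
  case (taut A)
  then show ?case by (subst sem_tval) (simp add: tautology_def)
qed (auto simp: sem_subst)

text \<open>In a single world without successors every boxed formula is true. This suffices to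
  compare box-free formulas by truth values.\<close>

lemma K_sound_dead_end: "K_provable A \<Longrightarrow> tval g (\<lambda>_. True) A"
  using K_sound[of A "\<lambda>_ _. False" "\<lambda>_. g" "()"] sem_tval[of "\<lambda>_ _. False" "\<lambda>_. g" "()" A]
  by simp

lemma sem_cls_eq: "cls A = cls B \<Longrightarrow> sem R V w A = sem R V w B"
  unfolding lindenbaum.abs_eq_iff K_equiv_iff using K_sound[of "Imp A B"] K_sound[of "Imp B A"] by force

lemma dead_end_cls_eq: "cls A = cls B \<Longrightarrow> tval g (\<lambda>_. True) A = tval g (\<lambda>_. True) B"
  unfolding lindenbaum.abs_eq_iff K_equiv_iff
  using K_sound_dead_end[of "Imp A B"] K_sound_dead_end[of "Imp B A"] by force

section \<open>The minterms of \<open>\<^bold>K[v,1]\<close>\<close>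

lemma tval_bool_minterm: "tval g h (bool_minterm v b) \<longleftrightarrow> (\<forall>k<v. g k = b k)"
  by (auto simp: bool_minterm_def ball_Un)

lemma vars_bool_minterm: "vars (bool_minterm v b) \<subseteq> {..<v}"
  by (auto simp: bool_minterm_def split: if_splits)

lemma deg_bool_minterm: "deg (bool_minterm v b) = 0"
proof -
  have "deg (bool_minterm v b) \<le> 0" unfolding bool_minterm_def by (rule deg_BigCon_le) auto
  then show ?thesis by simp
qed

lemma bool_minterm_eq_iff: "bool_minterm v b = bool_minterm v b' \<longleftrightarrow> (\<forall>k<v. b k = b' k)"
proof
  assume "bool_minterm v b = bool_minterm v b'"
  then have "tval b (\<lambda>_. True) (bool_minterm v b')"
    by (simp add: tval_bool_minterm flip: \<open>bool_minterm v b = bool_minterm v b'\<close>)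
  then show "\<forall>k<v. b k = b' k" by (simp add: tval_bool_minterm)
next
  assume "\<forall>k<v. b k = b' k"
  then show "bool_minterm v b = bool_minterm v b'"
    unfolding bool_minterm_def by (intro arg_cong[of _ _ BigCon]) auto
qed

section \<open>Indices of Boolean minterms versus valuations\<close>

locale bool_minterm_enumeration =
  fixes v :: nat and m :: "nat \<Rightarrow> fm"
  assumes enum: "enumerates_bool_minterms v m"
begin

abbreviation n :: nat where "n \<equiv> 2 ^ v"

text \<open>The index of the unique \<open>m i\<close> true under \<open>g\<close>. With
  \<open>point\<close> it identifies the indices below \<open>n\<close> with valuations up to
  agreement on the first \<open>v\<close> variables.\<close>

definition idx :: "(nat \<Rightarrow> bool) \<Rightarrow> nat" where
  "idx g = inv_into {..<n} m (bool_minterm v g)"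

text \<open>A valuation making \<open>m i\<close> true. Its values at \<open>k \<ge> v\<close> are
  whatever the choice returns, which is why \<open>point_idx\<close> assumes
  \<open>k < v\<close>.\<close>

definition point :: "nat \<Rightarrow> nat \<Rightarrow> bool" where
  "point i = (SOME g. m i = bool_minterm v g)"

lemma bij_m: "bij_betw m {..<n} (range (bool_minterm v))"
  using enum by (simp add: enumerates_bool_minterms_def)

lemma idx_less [simp]: "idx g < n"
  using bij_m unfolding idx_def by (metis bij_betw_def inv_into_into lessThan_iff rangeI)

lemma m_idx: "m (idx g) = bool_minterm v g"
  using bij_m unfolding idx_def by (metis bij_betw_def f_inv_into_f rangeI)

lemma m_eq:
  assumes "i < n"
  shows "m i = bool_minterm v (point i)"
proof -
  have "m i \<in> range (bool_minterm v)" using bij_m assms by (auto simp: bij_betw_def)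
  then have "\<exists>g. m i = bool_minterm v g" by blast
  then show ?thesis unfolding point_def by (rule someI_ex)
qed

lemma idx_eqI: "i < n \<Longrightarrow> m i = bool_minterm v g \<Longrightarrow> idx g = i"
  using bij_m unfolding idx_def by (metis bij_betw_def inv_into_f_f lessThan_iff)

lemma idx_point [simp]: "i < n \<Longrightarrow> idx (point i) = i"
  by (rule idx_eqI) (auto simp: m_eq)

lemma idx_eq_iff: "idx g = idx g' \<longleftrightarrow> (\<forall>k<v. g k = g' k)"
  by (metis bool_minterm_eq_iff idx_eqI idx_less m_idx)

lemma point_idx: "k < v \<Longrightarrow> point (idx g) k = g k"
  using idx_eq_iff[of "point (idx g)" g] by simp

lemma tval_m: "i < n \<Longrightarrow> tval g h (m i) \<longleftrightarrow> idx g = i"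
  using idx_eq_iff[of g "point i"] by (simp add: m_eq tval_bool_minterm)

lemma vars_m: "i < n \<Longrightarrow> vars (m i) \<subseteq> {..<v}"
  by (simp add: m_eq vars_bool_minterm)

lemma deg_m: "i < n \<Longrightarrow> deg (m i) = 0"
  by (simp add: m_eq deg_bool_minterm)

section \<open>Candidate minterms and the models separating them\<close>

definition minterm_fm :: "nat \<Rightarrow> (nat \<Rightarrow> bool) \<Rightarrow> fm" where
  "minterm_fm s \<epsilon> = Con (m s) (BigCon (map (\<lambda>i. Dia_sgn (\<epsilon> i) (m i)) [0..<n]))"

lemma minterm1_eq: "minterm1 v m s \<epsilon> = cls (minterm_fm s \<epsilon>)"
  by (simp add: minterm1_def minterm_fm_def)

text \<open>\<open>Dia A\<close> unfolds to \<open>Neg (Box (Neg A))\<close>, so the sign at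
  \<open>i\<close> is read off from \<open>h (Neg (m i))\<close>.\<close>

lemma tval_minterm_fm:
  "s < n \<Longrightarrow> tval g h (minterm_fm s \<epsilon>) \<longleftrightarrow> idx g = s \<and> (\<forall>i<n. \<epsilon> i \<longleftrightarrow> \<not> h (Neg (m i)))"
  by (auto simp: minterm_fm_def Dia_sgn_def tval_m ball_Un)

lemma minterm1_cong:
  "s < n \<Longrightarrow> (\<And>i. i < n \<Longrightarrow> \<epsilon> i = \<epsilon>' i) \<Longrightarrow> minterm1 v m s \<epsilon> = minterm1 v m s \<epsilon>'"
  unfolding minterm1_eq by (rule cls_eq_if_tval_eq) (auto simp: tval_minterm_fm)

text \<open>The root is \<open>None\<close>; its successors, the worlds \<open>Some i\<close> with \<open>\<epsilon> i\<close>, are dead ends.\<close>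

definition root_rel :: "(nat \<Rightarrow> bool) \<Rightarrow> nat option \<Rightarrow> nat option \<Rightarrow> bool" where
  "root_rel \<epsilon> w u \<longleftrightarrow> w = None \<and> (\<exists>i<n. \<epsilon> i \<and> u = Some i)"

definition root_val :: "nat \<Rightarrow> nat option \<Rightarrow> nat \<Rightarrow> bool" where
  "root_val s w = point (case w of None \<Rightarrow> s | Some i \<Rightarrow> i)"

text \<open>The root carries the valuation \<open>point s\<close> and sees exactly the points
  \<open>i\<close> with \<open>\<epsilon> i\<close>, so \<open>Dia (m i)\<close> holds there iff
  \<open>\<epsilon> i\<close>. Its truth values tell the candidates apart in
  \<open>minterm1_eq_iff\<close>.\<close>

lemma sem_root_minterm_fm:
  assumes "s < n" "s' < n"
  shows "sem (root_rel \<epsilon>) (root_val s) None (minterm_fm s' \<epsilon>') \<longleftrightarrow> s = s' \<and> (\<forall>i<n. \<epsilon> i = \<epsilon>' i)"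
proof -
  have sem_m: "sem (root_rel \<epsilon>) (root_val s) u (m i) \<longleftrightarrow> idx (root_val s u) = i" if "i < n" for u i
    using that by (subst sem_tval) (simp add: tval_m)
  have "(\<forall>u. root_rel \<epsilon> None u \<longrightarrow> sem (root_rel \<epsilon>) (root_val s) u (Neg (m i))) \<longleftrightarrow> \<not> \<epsilon> i"
    if "i < n" for i
    using that by (auto simp: sem_m root_rel_def root_val_def)
  then show ?thesis
    using assms by (subst sem_tval) (auto simp: tval_minterm_fm root_val_def)
qed

lemma minterm1_eq_iff:
  assumes "s < n" "s' < n"
  shows "minterm1 v m s \<epsilon> = minterm1 v m s' \<epsilon>' \<longleftrightarrow> s = s' \<and> (\<forall>i<n. \<epsilon> i = \<epsilon>' i)"
proof
  assume "minterm1 v m s \<epsilon> = minterm1 v m s' \<epsilon>'"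
  then show "s = s' \<and> (\<forall>i<n. \<epsilon> i = \<epsilon>' i)"
    using sem_cls_eq[of _ _ "root_rel \<epsilon>" "root_val s" None] assms
    unfolding minterm1_eq by (metis sem_root_minterm_fm)
next
  assume "s = s' \<and> (\<forall>i<n. \<epsilon> i = \<epsilon>' i)"
  then show "minterm1 v m s \<epsilon> = minterm1 v m s' \<epsilon>'"
    using minterm1_cong[OF assms(1), of \<epsilon> \<epsilon>'] by simp
qed

section \<open>The candidates are exactly the atoms\<close>

lemma minterm1_ne_bot:
  assumes "s < n"
  shows "minterm1 v m s \<epsilon> \<noteq> bot"
proof
  assume "minterm1 v m s \<epsilon> = bot"
  then have "cls (minterm_fm s \<epsilon>) = cls Fls"
    by (simp add: minterm1_eq bot_lindenbaum.abs_eq)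
  then show False
    using sem_cls_eq[of _ _ "root_rel \<epsilon>" "root_val s" None] assms sem_root_minterm_fm[of s s]
    by fastforce
qed

lemma minterm1_in_K_ctx:
  assumes "s < n"
  shows "minterm1 v m s \<epsilon> \<in> K_ctx v 1"
proof -
  have "vars (minterm_fm s \<epsilon>) \<subseteq> {..<v}"
    using assms vars_m by (fastforce simp: minterm_fm_def Dia_sgn_def split: if_splits)
  moreover have "deg (BigCon (map (\<lambda>i. Dia_sgn (\<epsilon> i) (m i)) [0..<n])) \<le> 1"
    by (rule deg_BigCon_le) (auto simp: Dia_sgn_def deg_m)
  then have "deg (minterm_fm s \<epsilon>) \<le> 1"
    using assms by (simp add: minterm_fm_def deg_m)
  ultimately show ?thesis by (auto simp: K_ctx_def minterm1_eq)
qed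

text \<open>In degree at most 1 the formula under a box is box-free, so its truth depends only on
  the index of the valuation. \<open>Box B\<close> is settled by whether \<open>B\<close> holds at
  all points that \<open>\<epsilon>\<close> admits.\<close>

lemma minterm_fm_decides:
  assumes "s < n" "vars A \<subseteq> {..<v}" "deg A \<le> 1"
  shows "K_provable (Imp (minterm_fm s \<epsilon>) A) \<or> K_provable (Imp (minterm_fm s \<epsilon>) (Neg A))"
  using assms(2,3)
proof (induction A)
  case (Var k)
  have "tval g h (minterm_fm s \<epsilon>) \<Longrightarrow> g k = point s k" for g h
    using Var assms(1) point_idx[of k g] by (auto simp: tval_minterm_fm)
  then have "tautology (Imp (minterm_fm s \<epsilon>) (if point s k then Var k else Neg (Var k)))"
    by (auto simp: tautology_def)
  then show ?case using taut by (metis (full_types))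
next
  case Fls
  then show ?case by (auto intro!: taut simp: tautology_def)
next
  case (Imp A B)
  let ?M = "minterm_fm s \<epsilon>"
  have "K_provable (Imp ?M A) \<or> K_provable (Imp ?M (Neg A))"
    "K_provable (Imp ?M B) \<or> K_provable (Imp ?M (Neg B))"
    using Imp by auto
  moreover have "K_provable (Imp ?M (Imp A B))" if "K_provable (Imp ?M B)"
    by (rule K_taut1[OF that]) (simp add: tautology_def)
  moreover have "K_provable (Imp ?M (Imp A B))" if "K_provable (Imp ?M (Neg A))"
    by (rule K_taut1[OF that]) (simp add: tautology_def)
  moreover have "K_provable (Imp ?M (Neg (Imp A B)))"
    if "K_provable (Imp ?M A)" "K_provable (Imp ?M (Neg B))"
    by (rule K_taut2[OF that]) (simp add: tautology_def)
  ultimately show ?case by blast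
next
  case (Box B)
  have B: "vars B \<subseteq> {..<v}" "deg B = 0" using Box by auto
  let ?M = "minterm_fm s \<epsilon>"
  have tval_B: "tval g h B = tval (point (idx g)) h' B" for g h h'
    using B by (intro tval_cong) (auto simp: point_idx subset_iff)
  show ?case
  proof (cases "\<forall>i<n. \<epsilon> i \<longrightarrow> tval (point i) (\<lambda>_. True) B")
    case True
    let ?Ps = "(\<lambda>i. Neg (m i)) ` {i. i < n \<and> \<not> \<epsilon> i}"
    have "K_provable (Imp ?M (Box B))"
    proof (rule K_box_consequence[of ?Ps])
      show "K_provable (Imp ?M (Box P))" if "P \<in> ?Ps" for P
        using that assms(1) by (auto intro!: taut simp: tautology_def tval_minterm_fm)
      show "tval g h B" if "\<And>P. P \<in> ?Ps \<Longrightarrow> tval g h P" for g h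
      proof -
        have "\<not> tval g h (Neg (m (idx g)))" by (simp add: tval_m)
        then have "Neg (m (idx g)) \<notin> ?Ps" using that by metis
        then have "\<epsilon> (idx g)" using idx_less[of g] by blast
        then show ?thesis using True tval_B[of g h "\<lambda>_. True"] by simp
      qed
    qed simp
    then show ?thesis ..
  next
    case False
    then obtain i where i: "i < n" "\<epsilon> i" "\<not> tval (point i) (\<lambda>_. True) B" by auto
    have "K_provable (Imp B (Neg (m i)))"
    proof (rule taut, unfold tautology_def, intro allI)
      show "tval g h (Imp B (Neg (m i)))" for g h
        using i tval_B[of g h "\<lambda>_. True"] by (auto simp: tval_m)
    qed
    then have "K_provable (Imp (Box B) (Box (Neg (m i))))" by (rule K_box_mono)
    then have "K_provable (Imp ?M (Neg (Box B)))"
      by (rule K_taut1) (use i assms(1) in \<open>auto simp: tautology_def tval_minterm_fm\<close>)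
    then show ?thesis ..
  qed
qed

lemma minterm1_decides:
  assumes "s < n" "x \<in> K_ctx v 1"
  shows "minterm1 v m s \<epsilon> \<le> x \<or> minterm1 v m s \<epsilon> \<le> - x"
proof -
  obtain A where "x = cls A" "vars A \<subseteq> {..<v}" "deg A \<le> 1" using assms(2) by (auto simp: K_ctx_def)
  then show ?thesis
    using minterm_fm_decides[OF assms(1), of A \<epsilon>]
    by (simp add: minterm1_eq less_eq_lindenbaum.abs_eq uminus_lindenbaum.abs_eq)
qed

text \<open>Every pair \<open>g\<close>, \<open>h\<close> satisfies some candidate, so the
  candidates exhaust all cases. Coding signs by subsets \<open>E\<close> of \<open>{..<n}\<close>
  keeps the set of premises finite.\<close>

lemma eq_bot_if_disjoint_minterms:
  assumes "\<And>s \<epsilon>. s < n \<Longrightarrow> minterm1 v m s \<epsilon> \<le> - x"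
  shows "x = bot"
proof -
  obtain A where x: "x = cls A" by (metis cls_rep)
  let ?Ps = "(\<lambda>(s, E). Imp (minterm_fm s (\<lambda>i. i \<in> E)) (Neg A)) ` ({..<n} \<times> Pow {..<n})"
  have "K_provable (Neg A)"
  proof (rule K_taut_consequence[of ?Ps])
    show "K_provable P" if "P \<in> ?Ps" for P
      using that assms
      by (auto simp: x minterm1_eq less_eq_lindenbaum.abs_eq uminus_lindenbaum.abs_eq)
    show "tval g h (Neg A)" if P: "\<And>P. P \<in> ?Ps \<Longrightarrow> tval g h P" for g h
    proof -
      \<comment> \<open>These signs make the candidate in section \<open>idx g\<close> true under
        \<open>g\<close> and \<open>h\<close>.\<close>
      let ?E = "{i. i < n \<and> \<not> h (Neg (m i))}"
      have "tval g h (Imp (minterm_fm (idx g) (\<lambda>i. i \<in> ?E)) (Neg A))"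
        by (rule P) (force intro!: image_eqI[of _ _ "(idx g, ?E)"])
      then show ?thesis by (simp add: tval_minterm_fm)
    qed
  qed simp
  then have "x \<le> bot" by (simp add: x bot_lindenbaum.abs_eq less_eq_lindenbaum.abs_eq)
  then show ?thesis by (simp add: bot_unique)
qed

text \<open>A nonzero element of the context is not disjoint from all candidates, so it lies above
  one, and an atom must equal it. Conversely, a candidate decides every element of the context, so
  only \<open>bot\<close> lies strictly below it there.\<close>

lemma minterms_eq: "minterms v 1 = {minterm1 v m s \<epsilon> | s \<epsilon>. s < n}"
proof (intro subset_antisym subsetI)
  fix x assume x: "x \<in> minterms v 1"
  then have "x \<noteq> bot" "x \<in> K_ctx v 1" by (auto simp: minterms_def)
  then obtain s \<epsilon> where s: "s < n" "minterm1 v m s \<epsilon> \<le> x"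
    using eq_bot_if_disjoint_minterms minterm1_decides by blast
  then have "minterm1 v m s \<epsilon> = x"
    using x minterm1_in_K_ctx minterm1_ne_bot by (auto simp: minterms_def)
  then show "x \<in> {minterm1 v m s \<epsilon> | s \<epsilon>. s < n}" using s by blast
next
  fix x assume "x \<in> {minterm1 v m s \<epsilon> | s \<epsilon>. s < n}"
  then obtain s \<epsilon> where s: "s < n" and x: "x = minterm1 v m s \<epsilon>" by auto
  have "y = bot \<or> y = x" if "y \<in> K_ctx v 1" "y \<le> x" for y
  proof -
    have "y \<le> - y" if "x \<le> - y" using that \<open>y \<le> x\<close> by (rule order_trans[rotated])
    then have "y = bot" if "x \<le> - y"
      using that by (metis inf.absorb1 inf_compl_bot)
    then show ?thesis
      using minterm1_decides[OF s \<open>y \<in> K_ctx v 1\<close>, of \<epsilon>] \<open>y \<le> x\<close> x by auto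
  qed
  then show "x \<in> minterms v 1"
    using s minterm1_in_K_ctx minterm1_ne_bot unfolding minterms_def x by blast
qed

section \<open>Prime substitutions as permutations\<close>

text \<open>The notation \<open>inv\<close> is taken by inverses in groups.\<close>

abbreviation inv' :: "('a \<Rightarrow> 'b) \<Rightarrow> 'b \<Rightarrow> 'a" where "inv' \<equiv> inv_into UNIV"

text \<open>Substitution commutes with connectives and box, so the sign at \<open>j\<close> moves to
  \<open>m (\<pi> j)\<close>. Reindexing by \<open>i = \<pi> j\<close> turns
  \<open>\<epsilon> j\<close> into \<open>\<epsilon> (inv' \<pi> i)\<close>.\<close>

lemma lsubst_minterm1:
  assumes \<pi>: "\<pi> permutes {..<n}"
    and \<sigma>: "\<And>j. j < n \<Longrightarrow> lsubst \<sigma> (cls (m j)) = cls (m (\<pi> j))"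
    and s: "s < n"
  shows "lsubst \<sigma> (minterm1 v m s \<epsilon>) = minterm1 v m (\<pi> s) (\<epsilon> \<circ> inv' \<pi>)"
proof -
  define t where "t = (\<lambda>k. rep_lind (\<sigma> k))"
  have \<sigma>_t: "\<sigma> = (\<lambda>k. cls (t k))" by (simp add: t_def cls_rep)
  have \<pi>_less: "\<pi> j < n" if "j < n" for j
    using permutes_in_image[OF \<pi>, of j] that by simp
  have equiv_m: "K_equiv (subst t (m j)) (m (\<pi> j))" if "j < n" for j
    using \<sigma>[OF that] by (simp add: \<sigma>_t lsubst_cls lindenbaum.abs_eq_iff)
  have equiv_box: "K_equiv (Box (Neg (subst t (m j)))) (Box (Neg (m (\<pi> j))))" if "j < n" for j
    by (intro K_equiv_Box K_equiv_Imp K_equiv_refl equiv_m that)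
  define iff where "iff A B = Con (Imp A B) (Imp B A)" for A B
  have tval_iff: "tval g h (iff A B) \<longleftrightarrow> tval g h A = tval g h B" for g h A B
    by (auto simp: iff_def)
  let ?A = "subst t (minterm_fm s \<epsilon>)" and ?B = "minterm_fm (\<pi> s) (\<epsilon> \<circ> inv' \<pi>)"
  \<comment> \<open>Boxed formulas are atoms for \<open>tval\<close>, so the equivalences needed
    under a box enter as separate premises.\<close>
  let ?Ps = "(\<lambda>j. iff (subst t (m j)) (m (\<pi> j))) ` {..<n}
    \<union> (\<lambda>j. iff (Box (Neg (subst t (m j)))) (Box (Neg (m (\<pi> j))))) ` {..<n}"
  have "K_provable (iff ?A ?B)"
  proof (rule K_taut_consequence[of ?Ps])
    show "K_provable P" if "P \<in> ?Ps" for P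
      using that equiv_m equiv_box by (auto simp: iff_def K_equiv_def)
    show "tval g h (iff ?A ?B)" if P: "\<And>P. P \<in> ?Ps \<Longrightarrow> tval g h P" for g h
    proof -
      have m_t: "tval g h (subst t (m j)) \<longleftrightarrow> idx g = \<pi> j" if "j < n" for j
        using P[of "iff (subst t (m j)) (m (\<pi> j))"] that by (auto simp: tval_iff tval_m \<pi>_less)
      have box_t: "h (Neg (subst t (m j))) = h (Neg (m (\<pi> j)))" if "j < n" for j
        using P[of "iff (Box (Neg (subst t (m j)))) (Box (Neg (m (\<pi> j))))"] that
        by (auto simp: tval_iff)
      have "tval g h ?A \<longleftrightarrow> idx g = \<pi> s \<and> (\<forall>i<n. \<epsilon> i \<longleftrightarrow> \<not> h (Neg (m (\<pi> i))))"
        using s by (auto simp: minterm_fm_def Dia_sgn_def m_t box_t)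
      also have "(\<forall>i<n. \<epsilon> i \<longleftrightarrow> \<not> h (Neg (m (\<pi> i)))) \<longleftrightarrow>
          (\<forall>i\<in>\<pi> ` {..<n}. \<epsilon> (inv' \<pi> i) \<longleftrightarrow> \<not> h (Neg (m i)))"
        by (auto simp: permutes_inverses[OF \<pi>])
      finally show ?thesis
        by (auto simp: tval_iff tval_minterm_fm \<pi>_less s permutes_image[OF \<pi>])
    qed
  qed simp
  then show ?thesis
    by (simp add: \<sigma>_t minterm1_eq lsubst_cls lindenbaum.abs_eq_iff K_equiv_def iff_def)
qed

text \<open>The dual action of the tuple: evaluating it at a point yields a new point. Points move
  in the direction opposite to formulas.\<close>

definition tuple_map :: "(nat \<Rightarrow> fm) \<Rightarrow> nat \<Rightarrow> nat" where
  "tuple_map t i = idx (\<lambda>k. tval (point i) (\<lambda>_. True) (t k))"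

lemma idx_tuple:
  assumes "\<And>k. k < v \<Longrightarrow> vars (t k) \<subseteq> {..<v} \<and> deg (t k) = 0"
  shows "idx (\<lambda>k. tval g h (t k)) = tuple_map t (idx g)"
  unfolding tuple_map_def idx_eq_iff
proof (intro allI impI)
  fix k assume "k < v"
  then show "tval g h (t k) = tval (point (idx g)) (\<lambda>_. True) (t k)"
    using assms by (intro tval_cong) (auto simp: point_idx subset_iff)
qed

lemma tval_subst_m:
  assumes "\<And>k. k < v \<Longrightarrow> vars (t k) \<subseteq> {..<v} \<and> deg (t k) = 0" "j < n"
  shows "tval g h (subst t (m j)) \<longleftrightarrow> tuple_map t (idx g) = j"
  using assms by (simp add: tval_subst[where h' = h] deg_m tval_m idx_tuple)

lemma subst_monoid_tuple:
  assumes "\<sigma> \<in> carrier (subst_monoid v)"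
  obtains t where "\<sigma> = (\<lambda>k. cls (t k))"
    "\<And>k. k < v \<Longrightarrow> vars (t k) \<subseteq> {..<v} \<and> deg (t k) = 0"
proof -
  have "\<exists>B. \<sigma> k = cls B \<and> (k < v \<longrightarrow> vars B \<subseteq> {..<v} \<and> deg B = 0)" for k
    using assms by (cases "k < v") (auto simp: subst_monoid_def K_ctx_def)
  then obtain t where "\<And>k. \<sigma> k = cls (t k)"
    "\<And>k. k < v \<Longrightarrow> vars (t k) \<subseteq> {..<v} \<and> deg (t k) = 0"
    by metis
  then show ?thesis using that[of t] by auto
qed

text \<open>A right inverse of \<open>\<sigma>\<close> makes its dual map surjective on the finite
  index set, hence a permutation \<open>\<rho>\<close>. The image of \<open>m j\<close> holds at the
  points that \<open>\<rho>\<close> sends to \<open>j\<close>, so the permutation on formulas is the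
  inverse of \<open>\<rho>\<close>.\<close>

lemma prime_subst_permutation:
  assumes "\<sigma> \<in> carrier (prime_substs v)"
  obtains \<pi> where "\<pi> permutes {..<n}" "\<And>j. j < n \<Longrightarrow> lsubst \<sigma> (cls (m j)) = cls (m (\<pi> j))"
proof -
  obtain \<sigma>' where carr: "\<sigma> \<in> carrier (subst_monoid v)" "\<sigma>' \<in> carrier (subst_monoid v)"
    and one: "\<sigma> \<otimes>\<^bsub>subst_monoid v\<^esub> \<sigma>' = \<one>\<^bsub>subst_monoid v\<^esub>"
    using assms by (auto simp: prime_substs_def units_of_def Units_def)
  obtain t where t: "\<sigma> = (\<lambda>k. cls (t k))"
    "\<And>k. k < v \<Longrightarrow> vars (t k) \<subseteq> {..<v} \<and> deg (t k) = 0"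
    using subst_monoid_tuple[OF carr(1)] by blast
  obtain t' where t': "\<sigma>' = (\<lambda>k. cls (t' k))"
    "\<And>k. k < v \<Longrightarrow> vars (t' k) \<subseteq> {..<v} \<and> deg (t' k) = 0"
    using subst_monoid_tuple[OF carr(2)] by blast
  let ?\<rho> = "tuple_map t"
  have "?\<rho> (tuple_map t' i) = i" if "i < n" for i
  proof -
    let ?g = "\<lambda>k. tval (point i) (\<lambda>_. True) (t' k)"
    have "cls (subst t' (t k)) = cls (Var k)" for k
      using fun_cong[OF one, of k] by (simp add: subst_monoid_def t(1) t'(1) lsubst_cls)
    \<comment> \<open>The composite is the identity only up to provable equivalence; evaluation at a
      dead end yields equal truth values.\<close>
    then have "tval (point i) (\<lambda>_. True) (subst t' (t k)) = point i k" for k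
      using dead_end_cls_eq[of "subst t' (t k)" "Var k" "point i"] by simp
    then have "tval ?g (\<lambda>_. True) (t k) = point i k" if "k < v" for k
      using t(2)[OF that] tval_subst[of "t k" "point i" "\<lambda>_. True" t' "\<lambda>_. True"] by simp
    then have "idx (\<lambda>k. tval ?g (\<lambda>_. True) (t k)) = idx (point i)"
      by (simp add: idx_eq_iff)
    moreover have "idx (\<lambda>k. tval ?g (\<lambda>_. True) (t k)) = ?\<rho> (idx ?g)"
      using t(2) by (rule idx_tuple)
    ultimately show ?thesis using that by (simp add: tuple_map_def[of t'])
  qed
  moreover have \<rho>_less: "tuple_map u i < n" for u i by (simp add: tuple_map_def)
  ultimately have "{..<n} \<subseteq> ?\<rho> ` {..<n}" by (metis imageI lessThan_iff subsetI)
  then have image: "?\<rho> ` {..<n} = {..<n}" using \<rho>_less by auto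
  then have "bij_betw ?\<rho> {..<n} {..<n}"
    by (simp add: bij_betw_def eq_card_imp_inj_on)
  \<comment> \<open>Extended by the identity from \<open>n\<close> on, as \<open>permutes\<close>
    demands.\<close>
  define \<rho> where "\<rho> = (\<lambda>i. if i < n then ?\<rho> i else i)"
  have "bij_betw \<rho> {..<n} {..<n}"
    using \<open>bij_betw ?\<rho> {..<n} {..<n}\<close> by (rule bij_betw_cong[THEN iffD1, rotated]) (simp add: \<rho>_def)
  then have perm: "\<rho> permutes {..<n}" by (rule bij_imp_permutes) (simp add: \<rho>_def)
  show ?thesis
  proof (rule that)
    show perm': "inv' \<rho> permutes {..<n}" using perm by (rule permutes_inv)
    have inv_less: "inv' \<rho> j < n" if "j < n" for j
      using that permutes_in_image[OF perm', of j] by simp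
    fix j assume j: "j < n"
    have "\<rho> (idx g) = j \<longleftrightarrow> idx g = inv' \<rho> j" for g
      using permutes_inverses[OF perm] by metis
    then have "?\<rho> (idx g) = j \<longleftrightarrow> idx g = inv' \<rho> j" for g by (simp add: \<rho>_def)
    then show "lsubst \<sigma> (cls (m j)) = cls (m (inv' \<rho> j))"
      unfolding t(1) lsubst_cls
      by (intro cls_eq_if_tval_eq) (simp add: tval_subst_m[OF t(2) j] tval_m[OF inv_less[OF j]])
  qed
qed

text \<open>A disjunctive normal form, written with \<open>BigCon\<close> by De Morgan: any Boolean
  function of the index is a box-free formula.\<close>

definition index_fm :: "(nat \<Rightarrow> bool) \<Rightarrow> fm" where
  "index_fm f = Neg (BigCon (map (\<lambda>i. Neg (m i)) (filter f [0..<n])))"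

lemma tval_index_fm: "tval g h (index_fm f) = f (idx g)"
  by (auto simp: index_fm_def tval_m)

lemma vars_index_fm: "vars (index_fm f) \<subseteq> {..<v}"
  using vars_m by (auto simp: index_fm_def)

lemma deg_index_fm: "deg (index_fm f) = 0"
proof -
  have "deg (BigCon (map (\<lambda>i. Neg (m i)) (filter f [0..<n]))) \<le> 0"
    by (rule deg_BigCon_le) (auto simp: deg_m)
  then show ?thesis by (simp add: index_fm_def)
qed

text \<open>The dual map must be the inverse of \<open>\<pi>\<close> for \<open>m j\<close> to go to
  \<open>m (\<pi> j)\<close>. Variables from \<open>v\<close> on stay fixed, as the encoding of
  tuples prescribes.\<close>

definition perm_tuple :: "(nat \<Rightarrow> nat) \<Rightarrow> nat \<Rightarrow> fm" where
  "perm_tuple \<pi> k = (if k < v then index_fm (\<lambda>i. point (inv' \<pi> i) k) else Var k)"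

lemma perm_tuple_closed: "k < v \<Longrightarrow> vars (perm_tuple \<pi> k) \<subseteq> {..<v} \<and> deg (perm_tuple \<pi> k) = 0"
  by (simp add: perm_tuple_def vars_index_fm deg_index_fm)

lemma perm_tuple_carrier: "(\<lambda>k. cls (perm_tuple \<pi> k)) \<in> carrier (subst_monoid v)"
  using perm_tuple_closed by (force simp: subst_monoid_def K_ctx_def perm_tuple_def)

lemma idx_perm_tuple:
  assumes "\<pi> permutes {..<n}"
  shows "idx (\<lambda>k. tval g h (perm_tuple \<pi> k)) = inv' \<pi> (idx g)"
proof -
  have "inv' \<pi> (idx g) < n"
    using permutes_in_image[OF permutes_inv[OF assms], of "idx g"] by simp
  moreover have "idx (\<lambda>k. tval g h (perm_tuple \<pi> k)) = idx (point (inv' \<pi> (idx g)))"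
    unfolding idx_eq_iff by (simp add: perm_tuple_def tval_index_fm)
  ultimately show ?thesis by simp
qed

text \<open>The dual maps of the two tuples cancel on indices, so each component below
  \<open>v\<close> has the truth value of its variable.\<close>

lemma perm_tuple_mult_inv:
  assumes "\<pi> permutes {..<n}" "\<pi>' permutes {..<n}" "\<And>i. \<pi>' (\<pi> i) = i"
  shows "(\<lambda>k. cls (perm_tuple \<pi> k)) \<otimes>\<^bsub>subst_monoid v\<^esub> (\<lambda>k. cls (perm_tuple \<pi>' k))
    = \<one>\<^bsub>subst_monoid v\<^esub>"
proof -
  have inv_inv: "inv' \<pi> (inv' \<pi>' i) = i" for i
    using assms permutes_inverses by (metis (no_types, lifting))
  have "cls (subst (perm_tuple \<pi>') (perm_tuple \<pi> k)) = cls (Var k)" for k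
  proof (cases "k < v")
    case True
    show ?thesis
    proof (rule cls_eq_if_tval_eq)
      fix g h
      have "tval g h (subst (perm_tuple \<pi>') (perm_tuple \<pi> k))
          = tval (\<lambda>k. tval g h (perm_tuple \<pi>' k)) h (perm_tuple \<pi> k)"
        using True perm_tuple_closed by (intro tval_subst) blast
      also have "\<dots> = point (inv' \<pi> (idx (\<lambda>k. tval g h (perm_tuple \<pi>' k)))) k"
        using True by (simp add: perm_tuple_def[of \<pi>] tval_index_fm)
      also have "\<dots> = g k"
        using True by (simp add: idx_perm_tuple[OF assms(2)] inv_inv point_idx)
      finally show "tval g h (subst (perm_tuple \<pi>') (perm_tuple \<pi> k)) = tval g h (Var k)" by simp
    qed
  qed (simp add: perm_tuple_def)
  then show ?thesis by (simp add: subst_monoid_def lsubst_cls)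
qed

text \<open>The tuple of the inverse permutation is a two-sided inverse, so the tuple of
  \<open>\<pi>\<close> is a unit.\<close>

lemma permutation_prime_subst:
  assumes \<pi>: "\<pi> permutes {..<n}"
  obtains \<sigma> where "\<sigma> \<in> carrier (prime_substs v)"
    "\<And>j. j < n \<Longrightarrow> lsubst \<sigma> (cls (m j)) = cls (m (\<pi> j))"
proof (rule that)
  let ?\<sigma> = "\<lambda>k. cls (perm_tuple \<pi> k)"
  have "?\<sigma> \<in> Units (subst_monoid v)"
    unfolding Units_def
    using perm_tuple_carrier[of \<pi>] perm_tuple_carrier[of "inv' \<pi>"]
      perm_tuple_mult_inv[OF \<pi> permutes_inv[OF \<pi>]] perm_tuple_mult_inv[OF permutes_inv[OF \<pi>] \<pi>]
    by (auto simp: permutes_inverses[OF \<pi>] intro!: bexI[of _ "\<lambda>k. cls (perm_tuple (inv' \<pi>) k)"])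
  then show "?\<sigma> \<in> carrier (prime_substs v)" by (simp add: prime_substs_def units_of_def)
  fix j assume j: "j < n"
  have "\<pi> j < n" using permutes_in_image[OF \<pi>, of j] j by simp
  moreover have "inv' \<pi> (idx g) = j \<longleftrightarrow> idx g = \<pi> j" for g
    using permutes_inverses[OF \<pi>] by metis
  ultimately show "lsubst ?\<sigma> (cls (m j)) = cls (m (\<pi> j))"
    unfolding lsubst_cls using j
    by (intro cls_eq_if_tval_eq)
      (simp add: tval_subst[where h' = "\<lambda>_. True"] deg_m tval_m idx_perm_tuple[OF \<pi>])
qed

section \<open>Orbits\<close>

definition others :: "nat \<Rightarrow> (nat \<Rightarrow> bool) \<Rightarrow> nat set" where
  "others s \<epsilon> = {i. i < n \<and> i \<noteq> s \<and> \<epsilon> i}"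

text \<open>One family for all four kinds: \<open>k = 0\<close> gives \<open>Vv0\<close> and
  \<open>Dd0\<close>, and positive \<open>k\<close> gives \<open>Dc\<close> and \<open>Dw\<close>,
  according to \<open>e\<close>.\<close>

definition orbit_class :: "bool \<Rightarrow> nat \<Rightarrow> lindenbaum set" where
  "orbit_class e k = {minterm1 v m s \<epsilon> | s \<epsilon>. s < n \<and> \<epsilon> s = e \<and> card (others s \<epsilon>) = k}"

lemma finite_others [simp]: "finite (others s \<epsilon>)"
  by (simp add: others_def)

lemma card_others_less:
  assumes "s < n"
  shows "card (others s \<epsilon>) < n"
proof -
  have "card (others s \<epsilon>) \<le> card ({..<n} - {s})"
    by (rule card_mono) (auto simp: others_def)
  also have "\<dots> < n" using assms by simp
  finally show ?thesis .
qed

text \<open>By \<open>minterm1_eq_iff\<close> the class determines \<open>s\<close> and the signs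
  below \<open>n\<close>, so both invariants are independent of the representation.\<close>

lemma minterm1_in_orbit_class_iff:
  assumes "s < n"
  shows "minterm1 v m s \<epsilon> \<in> orbit_class e k \<longleftrightarrow> \<epsilon> s = e \<and> card (others s \<epsilon>) = k"
proof
  assume "minterm1 v m s \<epsilon> \<in> orbit_class e k"
  then obtain s' \<epsilon>' where *: "minterm1 v m s \<epsilon> = minterm1 v m s' \<epsilon>'" "s' < n"
    "\<epsilon>' s' = e" "card (others s' \<epsilon>') = k"
    by (auto simp: orbit_class_def)
  then have eq: "s' = s" "\<forall>i<n. \<epsilon> i = \<epsilon>' i" using assms by (auto simp: minterm1_eq_iff)
  then have "others s' \<epsilon>' = others s \<epsilon>" by (auto simp: others_def)
  then show "\<epsilon> s = e \<and> card (others s \<epsilon>) = k" using * eq by auto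
qed (use assms in \<open>auto simp: orbit_class_def\<close>)

text \<open>Indices split into the section, the other positive ones and the other negative ones.
  Since the total is \<open>n\<close>, equally many positive ones leave equally many negative ones,
  and bijections of the three parts are glued.\<close>

lemma exists_matching_permutation:
  assumes "s < n" "s' < n" "\<epsilon> s = \<epsilon>' s'" "card (others s \<epsilon>) = card (others s' \<epsilon>')"
  obtains \<pi> where "\<pi> permutes {..<n}" "\<pi> s = s'" "\<And>i. i < n \<Longrightarrow> \<epsilon> i = \<epsilon>' (\<pi> i)"
proof -
  have compl: "{..<n} = {s} \<union> (others s \<epsilon> \<union> others s (Not \<circ> \<epsilon>))" if "s < n" for s \<epsilon>
    using that by (auto simp: others_def)
  have "card {..<n} = 1 + (card (others s \<epsilon>) + card (others s (Not \<circ> \<epsilon>)))" if "s < n" for s \<epsilon>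
  proof -
    have "card (others s \<epsilon> \<union> others s (Not \<circ> \<epsilon>)) = card (others s \<epsilon>) + card (others s (Not \<circ> \<epsilon>))"
      by (rule card_Un_disjoint) (auto simp: others_def)
    moreover have "s \<notin> others s \<epsilon> \<union> others s (Not \<circ> \<epsilon>)" by (simp add: others_def)
    ultimately show ?thesis by (simp add: compl[OF that, of \<epsilon>] del: card_lessThan)
  qed
  from this[OF assms(1), of \<epsilon>] this[OF assms(2), of \<epsilon>'] assms(4)
  have "card (others s (Not \<circ> \<epsilon>)) = card (others s' (Not \<circ> \<epsilon>'))" by simp
  then obtain f g where f: "bij_betw f (others s \<epsilon>) (others s' \<epsilon>')"
    and g: "bij_betw g (others s (Not \<circ> \<epsilon>)) (others s' (Not \<circ> \<epsilon>'))"
    using assms(4) by (metis finite_others finite_same_card_bij)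
  define \<pi> where
    "\<pi> i = (if i < n then if i = s then s' else if \<epsilon> i then f i else g i else i)" for i
  have f': "bij_betw \<pi> (others s \<epsilon>) (others s' \<epsilon>')"
    using f by (rule bij_betw_cong[THEN iffD1, rotated]) (auto simp: \<pi>_def others_def)
  have g': "bij_betw \<pi> (others s (Not \<circ> \<epsilon>)) (others s' (Not \<circ> \<epsilon>'))"
    using g by (rule bij_betw_cong[THEN iffD1, rotated]) (auto simp: \<pi>_def others_def)
  have s: "\<pi> s = s'" using assms(1) by (simp add: \<pi>_def)
  have "bij_betw \<pi> {s} {s'}" using s by simp
  then have "bij_betw \<pi> ({s} \<union> (others s \<epsilon> \<union> others s (Not \<circ> \<epsilon>)))
      ({s'} \<union> (others s' \<epsilon>' \<union> others s' (Not \<circ> \<epsilon>')))"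
    by (intro bij_betw_combine f' g') (auto simp: others_def)
  then have "bij_betw \<pi> {..<n} {..<n}"
    using compl[OF assms(1), of \<epsilon>] compl[OF assms(2), of \<epsilon>'] by simp
  then have "\<pi> permutes {..<n}" by (rule bij_imp_permutes) (simp add: \<pi>_def)
  moreover have "\<epsilon> i = \<epsilon>' (\<pi> i)" if "i < n" for i
  proof -
    consider "i = s" | "i \<in> others s \<epsilon>" | "i \<in> others s (Not \<circ> \<epsilon>)"
      using \<open>i < n\<close> compl[OF assms(1), of \<epsilon>] by blast
    then show ?thesis
    proof cases
      case 1
      then show ?thesis using s assms(3) by simp
    next
      case 2
      then have "\<pi> i \<in> others s' \<epsilon>'" using f' by (rule bij_betw_apply[rotated])
      then show ?thesis using 2 by (simp add: others_def)
    next
      case 3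
      then have "\<pi> i \<in> others s' (Not \<circ> \<epsilon>')" using g' by (rule bij_betw_apply[rotated])
      then show ?thesis using 3 by (simp add: others_def)
    qed
  qed
  ultimately show ?thesis using that s by blast
qed

text \<open>Permutations preserve the two invariants; conversely, equal invariants yield a matching
  permutation, which some prime substitution realises.\<close>

lemma orbit_minterm1:
  assumes s: "s < n"
  shows "orbit (prime_substs v) lsubst (minterm1 v m s \<epsilon>) = orbit_class (\<epsilon> s) (card (others s \<epsilon>))"
proof (intro subset_antisym subsetI)
  fix x assume "x \<in> orbit (prime_substs v) lsubst (minterm1 v m s \<epsilon>)"
  then obtain \<sigma> where \<sigma>: "\<sigma> \<in> carrier (prime_substs v)" and x: "x = lsubst \<sigma> (minterm1 v m s \<epsilon>)"
    by (auto simp: orbit_def)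
  obtain \<pi> where \<pi>: "\<pi> permutes {..<n}"
    "\<And>j. j < n \<Longrightarrow> lsubst \<sigma> (cls (m j)) = cls (m (\<pi> j))"
    using prime_subst_permutation[OF \<sigma>] by blast
  have \<pi>_less: "\<pi> i < n \<longleftrightarrow> i < n" for i using permutes_in_image[OF \<pi>(1), of i] by simp
  \<comment> \<open>The positive indices move along with \<open>\<pi>\<close>, so injectivity
    preserves their number.\<close>
  have "others (\<pi> s) (\<epsilon> \<circ> inv' \<pi>) = \<pi> ` others s \<epsilon>"
  proof (intro subset_antisym subsetI)
    fix i assume "i \<in> others (\<pi> s) (\<epsilon> \<circ> inv' \<pi>)"
    then have "inv' \<pi> i \<in> others s \<epsilon>"
      using \<pi>_less[of "inv' \<pi> i"] by (auto simp: others_def permutes_inverses[OF \<pi>(1)])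
    then show "i \<in> \<pi> ` others s \<epsilon>"
      by (rule image_eqI[rotated]) (simp add: permutes_inverses[OF \<pi>(1)])
  qed (auto simp: others_def \<pi>_less permutes_inverses[OF \<pi>(1)] dest: injD[OF permutes_inj[OF \<pi>(1)]])
  then have "card (others (\<pi> s) (\<epsilon> \<circ> inv' \<pi>)) = card (others s \<epsilon>)"
    by (simp add: card_image inj_on_subset[OF permutes_inj[OF \<pi>(1)]])
  then show "x \<in> orbit_class (\<epsilon> s) (card (others s \<epsilon>))"
    using s by (simp add: x lsubst_minterm1[OF \<pi> s] minterm1_in_orbit_class_iff \<pi>_less
        permutes_inverses[OF \<pi>(1)])
next
  fix x assume "x \<in> orbit_class (\<epsilon> s) (card (others s \<epsilon>))"
  then obtain s' \<epsilon>' where x: "x = minterm1 v m s' \<epsilon>'" and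
    *: "s' < n" "\<epsilon> s = \<epsilon>' s'" "card (others s \<epsilon>) = card (others s' \<epsilon>')"
    by (auto simp: orbit_class_def)
  obtain \<pi> where \<pi>: "\<pi> permutes {..<n}" "\<pi> s = s'" "\<And>i. i < n \<Longrightarrow> \<epsilon> i = \<epsilon>' (\<pi> i)"
    using exists_matching_permutation[of s s' \<epsilon> \<epsilon>'] s * by blast
  obtain \<sigma> where \<sigma>: "\<sigma> \<in> carrier (prime_substs v)"
    "\<And>j. j < n \<Longrightarrow> lsubst \<sigma> (cls (m j)) = cls (m (\<pi> j))"
    using permutation_prime_subst[OF \<pi>(1)] by blast
  have "lsubst \<sigma> (minterm1 v m s \<epsilon>) = minterm1 v m s' (\<epsilon> \<circ> inv' \<pi>)"
    using lsubst_minterm1[OF \<pi>(1) \<sigma>(2) s] \<pi>(2) by simp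
  also have "\<dots> = x"
    unfolding x
  \<comment> \<open>The sign functions need agree only below \<open>n\<close>.\<close>
  proof (rule minterm1_cong[OF *(1)])
    fix i assume "i < n"
    then have "inv' \<pi> i < n" using permutes_in_image[OF permutes_inv[OF \<pi>(1)], of i] by simp
    then show "(\<epsilon> \<circ> inv' \<pi>) i = \<epsilon>' i" by (simp add: \<pi>(3) permutes_inverses[OF \<pi>(1)])
  qed
  finally show "x \<in> orbit (prime_substs v) lsubst (minterm1 v m s \<epsilon>)"
    using \<sigma>(1) by (auto simp: orbit_def)
qed

section \<open>Counting minterms within a section\<close>

lemma inj_on_subset_minterm1:
  assumes "s < n"
  shows "inj_on (\<lambda>B. minterm1 v m s (\<lambda>i. i \<in> B \<or> i = s \<and> e)) (Pow ({..<n} - {s}))"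
proof (rule inj_onI)
  fix B C assume BC: "B \<in> Pow ({..<n} - {s})" "C \<in> Pow ({..<n} - {s})"
    and "minterm1 v m s (\<lambda>i. i \<in> B \<or> i = s \<and> e) = minterm1 v m s (\<lambda>i. i \<in> C \<or> i = s \<and> e)"
  then have *: "\<forall>i<n. (i \<in> B \<or> i = s \<and> e) = (i \<in> C \<or> i = s \<and> e)"
    using assms by (simp add: minterm1_eq_iff)
  have "i \<in> B \<longleftrightarrow> i \<in> C" for i
  proof (cases "i < n \<and> i \<noteq> s")
    case True
    then show ?thesis using *[rule_format, of i] by blast
  next
    case False
    then show ?thesis using BC by auto
  qed
  then show "B = C" by blast
qed

text \<open>Inside a section a minterm is recovered from \<open>B = others s \<epsilon>\<close>; the
  disjunct \<open>i = s \<and> e\<close> restores the sign at \<open>s\<close>.\<close>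

lemma orbit_class_Int_section:
  assumes "s < n"
  shows "orbit_class e k \<inter> section_minterms v m s =
    (\<lambda>B. minterm1 v m s (\<lambda>i. i \<in> B \<or> i = s \<and> e)) ` {B. B \<subseteq> {..<n} - {s} \<and> card B = k}"
    (is "_ = ?f ` _")
proof (intro subset_antisym subsetI)
  fix x assume "x \<in> orbit_class e k \<inter> section_minterms v m s"
  then obtain \<epsilon> where x: "x = minterm1 v m s \<epsilon>" and "\<epsilon> s = e" "card (others s \<epsilon>) = k"
    using assms by (auto simp: section_minterms_def minterm1_in_orbit_class_iff)
  moreover have "x = ?f (others s \<epsilon>)"
    unfolding x by (rule minterm1_cong[OF assms]) (use \<open>\<epsilon> s = e\<close> in \<open>auto simp: others_def\<close>)
  ultimately show "x \<in> ?f ` {B. B \<subseteq> {..<n} - {s} \<and> card B = k}"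
    by (intro image_eqI[of _ _ "others s \<epsilon>"]) (auto simp: others_def)
next
  fix x assume "x \<in> ?f ` {B. B \<subseteq> {..<n} - {s} \<and> card B = k}"
  then obtain B where B: "B \<subseteq> {..<n} - {s}" "card B = k" and x: "x = ?f B" by auto
  have "others s (\<lambda>i. i \<in> B \<or> i = s \<and> e) = B" using B(1) by (auto simp: others_def)
  moreover have "s \<notin> B" using B(1) by auto
  ultimately show "x \<in> orbit_class e k \<inter> section_minterms v m s"
    using assms B(2) by (auto simp: x section_minterms_def minterm1_in_orbit_class_iff)
qed

lemma card_orbit_class_Int_section:
  assumes "s < n"
  shows "card (orbit_class e k \<inter> section_minterms v m s) = (n - 1) choose k"
proof -
  have "card (orbit_class e k \<inter> section_minterms v m s)
      = card {B. B \<subseteq> {..<n} - {s} \<and> card B = k}"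
    unfolding orbit_class_Int_section[OF assms]
    by (rule card_image) (rule inj_on_subset[OF inj_on_subset_minterm1[OF assms]], auto)
  also have "\<dots> = (n - 1) choose k" using assms by (simp add: n_subsets)
  finally show ?thesis .
qed

lemma orbit_class_nonempty:
  assumes "k < n"
  shows "orbit_class e k \<noteq> {}"
proof -
  have "card (orbit_class e k \<inter> section_minterms v m 0) \<noteq> 0"
    using assms by (subst card_orbit_class_Int_section) (auto simp: binomial_eq_0_iff)
  then show ?thesis by auto
qed

text \<open>The orbit of a minterm is the class of its invariants, with \<open>k < n\<close> since
  the section itself is not counted. Conversely, each such class has a member and is its
  orbit.\<close>

lemma prime_orbits_eq: "prime_orbits v 1 = case_prod orbit_class ` (UNIV \<times> {..<n})"
proof (intro subset_antisym subsetI)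
  fix X assume "X \<in> prime_orbits v 1"
  then obtain s \<epsilon> where "s < n" "X = orbit (prime_substs v) lsubst (minterm1 v m s \<epsilon>)"
    unfolding prime_orbits_def orbits_def minterms_eq by blast
  then have "X = case_prod orbit_class (\<epsilon> s, card (others s \<epsilon>))" "card (others s \<epsilon>) < n"
    by (simp_all add: orbit_minterm1 card_others_less)
  then show "X \<in> case_prod orbit_class ` (UNIV \<times> {..<n})" by blast
next
  fix X assume "X \<in> case_prod orbit_class ` (UNIV \<times> {..<n})"
  then obtain e k where X: "X = orbit_class e k" "k < n" by auto
  then obtain s \<epsilon> where "s < n" "\<epsilon> s = e" "card (others s \<epsilon>) = k"
    using orbit_class_nonempty[of k e] by (auto simp: orbit_class_def)
  then have "X = orbit (prime_substs v) lsubst (minterm1 v m s \<epsilon>)" "minterm1 v m s \<epsilon> \<in> minterms v 1"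
    unfolding minterms_eq by (auto simp: X orbit_minterm1)
  then show "X \<in> prime_orbits v 1" unfolding prime_orbits_def orbits_def by blast
qed

text \<open>Any common member of two equal classes recovers \<open>e\<close> and
  \<open>k\<close>.\<close>

lemma inj_on_orbit_class: "inj_on (case_prod orbit_class) (UNIV \<times> {..<n})"
proof (rule inj_onI)
  fix p p' assume *: "p \<in> UNIV \<times> {..<n}" "case_prod orbit_class p = case_prod orbit_class p'"
  obtain e k e' k' where p: "p = (e, k)" "p' = (e', k')" by (metis surj_pair)
  have "k < n" using *(1) by (simp add: p)
  have eq: "orbit_class e k = orbit_class e' k'" using *(2) unfolding p prod.case .
  obtain x where "x \<in> orbit_class e k" using orbit_class_nonempty[OF \<open>k < n\<close>] by blast
  moreover from this obtain s \<epsilon> where s: "s < n" "x = minterm1 v m s \<epsilon>"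
    unfolding orbit_class_def by blast
  ultimately have "minterm1 v m s \<epsilon> \<in> orbit_class e k" "minterm1 v m s \<epsilon> \<in> orbit_class e' k'"
    using eq by simp_all
  then show "p = p'"
    unfolding p minterm1_in_orbit_class_iff[OF s(1)] by simp
qed

lemma card_prime_orbits: "card (prime_orbits v 1) = 2 * n"
  unfolding prime_orbits_eq by (simp add: card_image[OF inj_on_orbit_class] card_cartesian_product)

lemma Dc_eq: "Dc v m k = orbit_class False k"
  by (simp add: Dc_def orbit_class_def others_def)

lemma Dw_eq: "Dw v m k = orbit_class True k"
  by (simp add: Dw_def orbit_class_def others_def)

lemma others_empty_iff: "card (others s \<epsilon>) = 0 \<longleftrightarrow> (\<forall>i<n. i \<noteq> s \<longrightarrow> \<not> \<epsilon> i)"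
  by (simp only: card_0_eq finite_others) (auto simp: others_def)

lemma Vv0_eq: "Vv0 v m = orbit_class False 0"
  unfolding Vv0_def orbit_class_def others_empty_iff by blast

lemma Dd0_eq: "Dd0 v m = orbit_class True 0"
  unfolding Dd0_def orbit_class_def others_empty_iff by auto

end

theorem theorem8:
  fixes v n :: nat and m :: "nat \<Rightarrow> fm"
  assumes "v \<ge> 1" and "n = 2 ^ v" and "enumerates_bool_minterms v m"
  shows "card (prime_orbits v 1) = 2 * n
    \<and> prime_orbits v 1 = {Vv0 v m, Dd0 v m} \<union> Dc v m ` {1..<n} \<union> Dw v m ` {1..<n}
    \<and> (\<forall>k \<in> {1..<n}. \<forall>s < n.
          card (Dc v m k \<inter> section_minterms v m s) = (n - 1) choose k
        \<and> card (Dw v m k \<inter> section_minterms v m s) = (n - 1) choose k)"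
proof -
  interpret bool_minterm_enumeration v m
    using assms(3) by unfold_locales
  \<comment> \<open>Splitting off \<open>k = 0\<close> separates \<open>Vv0\<close> and
    \<open>Dd0\<close> from the families with \<open>1 \<le> k\<close>.\<close>
  have "{..<n} = insert 0 {1..<n}" using assms(2) by auto
  then have "case_prod orbit_class ` (UNIV \<times> {..<n}) =
      {Vv0 v m, Dd0 v m} \<union> Dc v m ` {1..<n} \<union> Dw v m ` {1..<n}"
    unfolding Vv0_eq Dd0_eq Dc_eq[abs_def] Dw_eq[abs_def] UNIV_bool by auto
  then show ?thesis
    using card_prime_orbits prime_orbits_eq card_orbit_class_Int_section assms(2)
    by (simp add: Dc_eq Dw_eq)
qed

end
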